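(* Let $G=(V,E)$ be a connected undirected graph with $n=|V|$ nodes, node degrees $\Delta_u$ ($u\in V$), maximum degree $\Delta$ and diameter $D$, and suppose $k$ messages are initially distributed among the nodes. Then prioritized round robin routing delivers all $k$ messages to every node within at most $\min\{3n, \Delta D\} + \Delta k$ rounds (deterministically).
   Context: Gossip model: communication proceeds in synchronous rounds; in each round every node may initiate one bidirectional exchange of a packet with one of its neighbors (both endpoints of an exchange send a packet to each other); a packet holds one message plus header information, and messages are forwarded without coding. Prioritized round robin routing: fix a total order on the $k$ messages. Each node $u$ fixes a cyclic order of its neighbors and in every round contacts the next neighbor in this cyclic list. Each node $u$ keeps, for each message it knows, a counter of how often it has sent out that message, and whenever it sends a packet it sends the smallest (in the fixed order) message it knows that it has not yet sent out $\Delta_u$ times (if such a message exists). *)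

theory Defs
  imports "Graph_Theory.Graph_Theory"
begin

section \<open>Degrees and distances\<close>

text \<open>
  A finite simple undirected graph is a \<^locale>\<open>pair_graph\<close>: a finite, loop-free and symmetric
  relation on the vertices. Each edge gives two opposite arcs, so the degree of a node is its
  out-degree.
\<close>

definition max_degree :: "'a pair_pre_digraph \<Rightarrow> nat" where
  "max_degree G = Max (out_degree (with_proj G) ` pverts G)"

definition graph_dist :: "'a pair_pre_digraph \<Rightarrow> 'a \<Rightarrow> 'a \<Rightarrow> nat" where
  "graph_dist G u v = (LEAST l. \<exists>p. pre_digraph.awalk (with_proj G) u p v \<and> length p = l)"

definition diameter :: "'a pair_pre_digraph \<Rightarrow> nat" where
  "diameter G = Max {graph_dist G u v |u v. u \<in> pverts G \<and> v \<in> pverts G}"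


section \<open>Prioritized round robin routing\<close>

text \<open>
  \<open>nbrs u\<close> lists the neighbors of \<open>u\<close> in cyclic order, beginning with the one that \<open>u\<close> contacts
  first. The order in which messages are prioritized is the linear order of the type of messages.
\<close>

definition neighbor_orders :: "'a pair_pre_digraph \<Rightarrow> ('a \<Rightarrow> 'a list) \<Rightarrow> bool" where
  "neighbor_orders G nbrs \<longleftrightarrow>
     (\<forall>u\<in>pverts G. distinct (nbrs u) \<and> set (nbrs u) = {v. (u, v) \<in> parcs G})"

text \<open>
  The arc condition only matters for an isolated node, which has nobody to contact, and for
  elements of the type that are not nodes.
\<close>

definition initiates ::
  "'a pair_pre_digraph \<Rightarrow> ('a \<Rightarrow> 'a list) \<Rightarrow> nat \<Rightarrow> 'a \<Rightarrow> 'a \<Rightarrow> bool" where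
  "initiates G nbrs t u v \<longleftrightarrow> (u, v) \<in> parcs G \<and> v = nbrs u ! (t mod length (nbrs u))"

definition exchange ::
  "'a pair_pre_digraph \<Rightarrow> ('a \<Rightarrow> 'a list) \<Rightarrow> nat \<Rightarrow> 'a \<Rightarrow> 'a \<Rightarrow> bool" where
  "exchange G nbrs t u v \<longleftrightarrow> initiates G nbrs t u v \<or> initiates G nbrs t v u"

record ('a, 'm) routing_state =
  known :: "'a \<Rightarrow> 'm set"
  sent :: "'a \<Rightarrow> 'm \<Rightarrow> nat"

definition packet ::
  "'a pair_pre_digraph \<Rightarrow> ('a, 'm :: linorder) routing_state \<Rightarrow> 'a \<Rightarrow> 'm option" where
  "packet G s u =
     (let P = {m \<in> known s u. sent s u m < out_degree (with_proj G) u}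
      in if P = {} then None else Some (Min P))"

text \<open>
  Rounds are synchronous: what is sent in a round depends on the state before that round only.
  So the message \<open>u\<close> sends in a round is the same in all exchanges that \<open>u\<close> takes part in, whether
  \<open>u\<close> initiated them or not, and its counter advances by one per round, that is, once per contact
  initiated by \<open>u\<close>. If the replies of \<open>u\<close> were counted as well, a few eager neighbors could use up
  all transmissions of a message, and the message might never reach the other neighbors.
\<close>

definition routing_step ::
  "'a pair_pre_digraph \<Rightarrow> ('a \<Rightarrow> 'a list) \<Rightarrow> nat \<Rightarrow>
   ('a, 'm :: linorder) routing_state \<Rightarrow> ('a, 'm) routing_state" where
  "routing_step G nbrs t s =
     \<lparr> known = (\<lambda>v. known s v \<union> {m. \<exists>u. exchange G nbrs t u v \<and> packet G s u = Some m}),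
       sent = (\<lambda>u m. sent s u m + (if packet G s u = Some m then 1 else 0)) \<rparr>"

primrec routing ::
  "'a pair_pre_digraph \<Rightarrow> ('a \<Rightarrow> 'a list) \<Rightarrow> ('a \<Rightarrow> 'm :: linorder set) \<Rightarrow> nat \<Rightarrow>
   ('a, 'm) routing_state" where
  "routing G nbrs init 0 = \<lparr> known = init, sent = (\<lambda>_ _. 0) \<rparr>"
| "routing G nbrs init (Suc t) = routing_step G nbrs t (routing G nbrs init t)"

end

theory Submission
  imports Defs
begin

text \<open>
  Follow a shortest walk from an initial holder of a message \<open>m\<close> to a node \<open>v\<close>. By induction along
  the walk, once the time has reached the degree sum of the walk so far plus \<open>\<Delta> q\<close>, the current node
  knows \<open>m\<close> or at least \<open>q\<close> of the messages up to \<open>m\<close>; for \<open>q\<close> the rank of \<open>m\<close> it knows \<open>m\<close>. In the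
  induction step, look at the last round in which the sender was idle with respect to the messages
  up to \<open>m\<close>: all those it knew were already exhausted, hence delivered, and since then every visit
  to the next node delivers a new one. This uses that a message is never sent twice to the same
  neighbor: it can only be preempted by smaller messages, and these take up complete tours of the
  neighbor list. Finally, the degree sum of a shortest walk is at most \<open>\<Delta> D\<close>, and at most \<open>3 n\<close>
  because each vertex is adjacent to at most three of its tails.
\<close>

section \<open>A single prioritized sender\<close>

text \<open>This isolates one node: the rest of the network enters only through the growing set
  \<open>known\<close>. The counter of a message is encoded as the number of earlier rounds with
  that packet.\<close>

locale prioritized_sender =
  fixes known :: "nat \<Rightarrow> 'm :: linorder set" and packet :: "nat \<Rightarrow> 'm option" and d :: nat
  assumes finite_known: "finite (known t)"
    and known_mono: "r \<le> t \<Longrightarrow> known r \<subseteq> known t"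
    and packet_eq: "packet t =
      (let P = {m \<in> known t. card {r. r < t \<and> packet r = Some m} < d}
       in if P = {} then None else Some (Min P))"
begin

definition sends :: "nat \<Rightarrow> 'm \<Rightarrow> nat" where
  "sends t m = card {r. r < t \<and> packet r = Some m}"

definition pending :: "nat \<Rightarrow> 'm set" where
  "pending t = {m \<in> known t. sends t m < d}"

lemma finite_pending: "finite (pending t)"
  using finite_known by (simp add: pending_def)

lemma packet_pending: "packet t = (if pending t = {} then None else Some (Min (pending t)))"
  using packet_eq[of t, folded sends_def, folded pending_def] by (simp add: Let_def)

lemma packet_SomeD:
  assumes "packet t = Some m"
  shows "m \<in> known t" "sends t m < d"
    and "\<And>m'. m' \<in> known t \<Longrightarrow> m' < m \<Longrightarrow> d \<le> sends t m'"
proof -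
  have ne: "pending t \<noteq> {}" and m: "m = Min (pending t)"
    using assms by (simp_all add: packet_pending split: if_splits)
  have "m \<in> pending t" using Min_in[OF finite_pending ne] m by simp
  then show "m \<in> known t" "sends t m < d" by (simp_all add: pending_def)
  show "d \<le> sends t m'" if "m' \<in> known t" "m' < m" for m'
  proof (rule ccontr)
    assume "\<not> d \<le> sends t m'"
    then have "m' \<in> pending t" using that(1) by (simp add: pending_def)
    then have "m \<le> m'" using Min_le[OF finite_pending] m by simp
    then show False using that(2) by simp
  qed
qed

text \<open>The negation is the useful side: then every known message up to \<open>m\<close> has
  used up its \<open>d\<close> transmissions.\<close>

definition busy :: "'m \<Rightarrow> nat \<Rightarrow> bool" where
  "busy m t \<longleftrightarrow> (\<exists>m'\<le>m. packet t = Some m')"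

lemma busyI:
  assumes "m \<in> known t" "sends t m < d"
  shows "busy m t"
proof -
  have m: "m \<in> pending t" using assms by (simp add: pending_def)
  then have "packet t = Some (Min (pending t))" by (auto simp: packet_pending)
  then show ?thesis using Min_le[OF finite_pending m] by (auto simp: busy_def)
qed

lemma busy_mono: "busy m t \<Longrightarrow> m \<le> m' \<Longrightarrow> busy m' t"
  by (auto simp: busy_def intro: order_trans)

section \<open>Transmission counts and residues of sending rounds\<close>

lemma sends_Suc: "sends (Suc t) m = sends t m + (if packet t = Some m then 1 else 0)"
proof -
  have "{r. r < Suc t \<and> packet r = Some m} =
      {r. r < t \<and> packet r = Some m} \<union> (if packet t = Some m then {t} else {})"
    by (auto simp: less_Suc_eq)
  then show ?thesis by (simp add: sends_def)
qed

lemma sends_le: "sends t m \<le> d"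
proof (induction t)
  case (Suc t)
  then show ?case using packet_SomeD(2)[of t m] by (auto simp: sends_Suc)
qed (simp add: sends_def)

lemma sends_mono: "r \<le> t \<Longrightarrow> sends r m \<le> sends t m"
  unfolding sends_def by (intro card_mono) auto

lemma sends_less:
  assumes "packet r = Some m" "r < t"
  shows "sends r m < sends t m"
  using sends_mono[of "Suc r" t m] assms by (simp add: sends_Suc)

text \<open>
  Whenever \<open>m\<close> is sent, every known smaller message is exhausted, so the rounds spent on smaller
  messages do not shift the position of \<open>m\<close> in the cyclic order.
\<close>

lemma dvd_rounds_smaller:
  assumes "packet t = Some m"
  shows "d dvd card {r. r < t \<and> (\<exists>m'<m. packet r = Some m')}"
proof -
  let ?F = "{m' \<in> known t. m' < m}"
  have "{r. r < t \<and> (\<exists>m'<m. packet r = Some m')} = (\<Union>m'\<in>?F. {r. r < t \<and> packet r = Some m'})"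
    using packet_SomeD(1) known_mono by (fastforce dest: less_imp_le)
  also have "card \<dots> = (\<Sum>m'\<in>?F. sends t m')"
    unfolding sends_def using finite_known by (intro card_UN_disjoint) auto
  also have "\<dots> = (\<Sum>m'\<in>?F. d)"
    using packet_SomeD(3)[OF assms] sends_le by (intro sum.cong) (auto intro: antisym)
  finally show ?thesis by simp
qed

text \<open>From \<open>r\<close> to \<open>t\<close> every round serves a message up to
  \<open>m\<close>, so \<open>t - r\<close> is the number of rounds given to smaller messages plus
  the number given to \<open>m\<close>. For equal residues, \<open>d\<close> divides the former and
  \<open>t - r\<close>, hence also the latter, which lies strictly between 0 and
  \<open>d\<close>.\<close>

lemma packet_residues_less:
  assumes "packet r = Some m" "packet t = Some m" "r < t"
  shows "r mod d \<noteq> t mod d"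
proof
  assume eq: "r mod d = t mod d"
  define c where "c s = card {x. x < s \<and> (\<exists>m'<m. packet x = Some m')}" for s
  have split: "card {x. x < s \<and> busy m x} = c s + sends s m" for s
  proof -
    have "{x. x < s \<and> busy m x} =
        {x. x < s \<and> (\<exists>m'<m. packet x = Some m')} \<union> {x. x < s \<and> packet x = Some m}"
      by (auto simp: busy_def le_less)
    also have "card \<dots> = c s + sends s m"
      unfolding c_def sends_def by (intro card_Un_disjoint) auto
    finally show ?thesis .
  qed
  have "busy m x" if "r \<le> x" "x < t" for x
  proof (rule busyI)
    show "m \<in> known x" using packet_SomeD(1)[OF assms(1)] known_mono that by blast
    show "sends x m < d"
      using sends_mono[of x t m] packet_SomeD(2)[OF assms(2)] that by simp
  qed
  then have "{x. x < t \<and> busy m x} = {x. x < r \<and> busy m x} \<union> {r..<t}"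
    using assms(3) by (auto simp: not_less)
  also have "card \<dots> = card {x. x < r \<and> busy m x} + (t - r)"
    by (subst card_Un_disjoint) auto
  finally have "c t + sends t m = c r + sends r m + (t - r)"
    by (simp add: split)
  moreover obtain x where "c t = d * x"
    using dvd_rounds_smaller[OF assms(2)] unfolding c_def by (rule dvdE)
  moreover obtain y where "c r = d * y"
    using dvd_rounds_smaller[OF assms(1)] unfolding c_def by (rule dvdE)
  moreover obtain z where "t - r = d * z"
    using eq assms(3) by (metis mod_eq_dvd_iff_nat less_imp_le dvdE)
  moreover have less: "sends r m < sends t m" using sends_less assms(1,3) .
  ultimately have "sends t m - sends r m = d * (y + z) - d * x"
    by (simp add: distrib_left)
  then have "d dvd sends t m - sends r m" by simp
  then show False
    using less packet_SomeD(2)[OF assms(2)]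
    by (auto dest: dvd_imp_le)
qed

lemma packet_residues_inj:
  "packet r = Some m \<Longrightarrow> packet t = Some m \<Longrightarrow> r mod d = t mod d \<Longrightarrow> r = t"
  by (metis linorder_neqE_nat packet_residues_less)

text \<open>The \<open>d\<close> transmissions have pairwise distinct residues modulo
  \<open>d\<close>, so they fill all of them: an exhausted message has gone out in every
  slot.\<close>

lemma exhausted_residue:
  assumes "d \<le> sends t m" "i < d"
  obtains r where "r < t" "r mod d = i" "packet r = Some m"
proof -
  let ?S = "{r. r < t \<and> packet r = Some m}"
  have "inj_on (\<lambda>r. r mod d) ?S" using packet_residues_inj by (auto intro!: inj_onI)
  then have "card ((\<lambda>r. r mod d) ` ?S) = d"
    using assms(1) sends_le[of t m] by (simp add: card_image sends_def)
  moreover have "(\<lambda>r. r mod d) ` ?S \<subseteq> {..<d}" using assms(2) by auto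
  ultimately have "(\<lambda>r. r mod d) ` ?S = {..<d}" by (intro card_subset_eq) auto
  then have "i \<in> (\<lambda>r. r mod d) ` ?S" using assms(2) by simp
  then show thesis using that by auto
qed

section \<open>Messages delivered in one slot of the tour\<close>

text \<open>For \<open>i\<close> the position of a neighbor in the cyclic list, these are the
  messages handed over in contacts that the sender itself initiates with that neighbor.\<close>

definition delivered :: "nat \<Rightarrow> nat \<Rightarrow> 'm set" where
  "delivered i t = {m. \<exists>r<t. r mod d = i \<and> packet r = Some m}"

lemma delivered_mono: "s \<le> t \<Longrightarrow> delivered i s \<subseteq> delivered i t"
  by (force simp: delivered_def)

lemma finite_delivered: "finite (delivered i t)"
proof -
  have "delivered i t \<subseteq> known t"
    unfolding delivered_def using packet_SomeD(1) known_mono by (fastforce dest: less_imp_le)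
  then show ?thesis using finite_known finite_subset by blast
qed

text \<open>The \<open>q\<close> tours visit slot \<open>i\<close> exactly \<open>q\<close> times,
  each time with a message up to \<open>m\<close>. As no message is repeated in a slot, these are
  distinct and new compared with \<open>A\<close>.\<close>

lemma busy_delivers:
  assumes "i < d"
    and busy_from: "\<And>r. b \<le> r \<Longrightarrow> r < b + d * q \<Longrightarrow> busy m r"
    and A: "finite A" "A \<subseteq> {m' \<in> delivered i b. m' \<le> m}"
  shows "card A + q \<le> card {m' \<in> delivered i (b + d * q). m' \<le> m}"
proof -
  \<comment> \<open>The first visit to slot \<open>i\<close> from round \<open>b\<close> on is in
    round \<open>b + e\<close>.\<close>
  obtain e where e: "e < d" "(b + e) mod d = i"
  proof
    show "(d - b mod d + i) mod d < d" using assms(1) by simp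
    have "(b + (d - b mod d + i) mod d) mod d = (b mod d + (d - b mod d + i)) mod d"
      by (simp add: mod_simps)
    also have "b mod d + (d - b mod d + i) = d + i" 
      using assms(1) mod_less_divisor[of d b] by linarith
    finally show "(b + (d - b mod d + i) mod d) mod d = i" using assms(1) by simp
  qed
  define x where "x j = b + e + d * j" for j
  have x: "b \<le> x j" "x j mod d = i" for j using e by (simp_all add: x_def)
  have x_less: "x j < b + d * q" if "j < q" for j
  proof -
    have "e + d * j < d * Suc j" using e by simp
    also have "\<dots> \<le> d * q" using that by (intro mult_le_mono2) simp
    finally show ?thesis by (simp add: x_def)
  qed
  define f where "f j = the (packet (x j))" for j
  have f: "packet (x j) = Some (f j)" "f j \<le> m" if "j < q" for j
    using busy_from[OF x(1) x_less[OF that]] by (auto simp: f_def busy_def)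
  have "inj_on f {..<q}"
  proof (rule inj_onI)
    fix j j' assume "j \<in> {..<q}" "j' \<in> {..<q}" "f j = f j'"
    then have "x j = x j'" using f x(2) packet_residues_inj by (metis lessThan_iff)
    then show "j = j'" using assms(1) by (simp add: x_def)
  qed
  moreover have "A \<inter> f ` {..<q} = {}"
  proof -
    have False if j: "j < q" "f j \<in> delivered i b" for j
    proof -
      obtain r where "r < b" "r mod d = i" "packet r = Some (f j)"
        using j(2) by (auto simp: delivered_def)
      then show False using packet_residues_inj[of r "f j" "x j"] f(1)[OF j(1)] x[of j] by auto
    qed
    then show ?thesis using A by blast
  qed
  ultimately have "card (A \<union> f ` {..<q}) = card A + q"
    using A(1) by (simp add: card_Un_disjoint card_image)
  moreover have "A \<union> f ` {..<q} \<subseteq> {m' \<in> delivered i (b + d * q). m' \<le> m}"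
  proof -
    have "f j \<in> delivered i (b + d * q)" if "j < q" for j
      using f(1)[OF that] x_less[OF that] x(2) by (auto simp: delivered_def)
    moreover have "delivered i b \<subseteq> delivered i (b + d * q)"
      by (rule delivered_mono) simp
    ultimately show ?thesis using A f(2) by auto
  qed
  moreover have "finite {m' \<in> delivered i (b + d * q). m' \<le> m}"
    using finite_delivered by simp
  ultimately show ?thesis by (metis card_mono)
qed

text \<open>This is one hop, with \<open>W\<close> the degree sum up to the sender. The guarantee
  lags by \<open>d\<close> only, for every \<open>q\<close>, since busy rounds deliver a new message
  every \<open>d\<close> rounds and the guarantee grows only every \<open>D\<close> rounds.\<close>

lemma delivered_of_known:
  assumes "i < d" "d \<le> D"
    and avail: "\<And>q. m \<in> known (W + D * q) \<or> q \<le> card {m' \<in> known (W + D * q). m' \<le> m}"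
  shows "m \<in> delivered i (W + d + D * q) \<or> q \<le> card {m' \<in> delivered i (W + d + D * q). m' \<le> m}"
proof -
  define T where "T = W + d + D * q"
  have d_le: "d * j \<le> D * j" for j using assms(2) by (rule mult_le_mono1)
  \<comment> \<open>It remains to find a round \<open>b\<close>, followed by busy rounds only, by
    which \<open>l\<close> messages are delivered and which leaves room for the missing
    \<open>q - l\<close> tours before \<open>T\<close>.\<close>
  have from_busy: "q \<le> card {m' \<in> delivered i T. m' \<le> m}"
    if b: "b + d * (q - l) \<le> T" "\<And>r. b \<le> r \<Longrightarrow> r < T \<Longrightarrow> busy m r"
      and A: "finite A" "A \<subseteq> {m' \<in> delivered i b. m' \<le> m}" "l \<le> card A" for b l A
  proof -
    have "card A + (q - l) \<le> card {m' \<in> delivered i (b + d * (q - l)). m' \<le> m}"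
    proof (rule busy_delivers[OF assms(1) _ A(1,2)])
      fix r assume "b \<le> r" "r < b + d * (q - l)"
      then show "busy m r" using b(1) by (intro b(2)) simp_all
    qed
    also have "\<dots> \<le> card {m' \<in> delivered i T. m' \<le> m}"
      using delivered_mono[OF b(1)] finite_delivered by (intro card_mono) auto
    finally show ?thesis using A(3) by simp
  qed
  have "m \<in> delivered i T \<or> q \<le> card {m' \<in> delivered i T. m' \<le> m}"
  proof (cases "\<exists>r<T. \<not> busy m r")
    case False
    moreover have "0 + d * (q - 0) \<le> T"
      using d_le[of q] by (simp add: T_def trans_le_add2)
    ultimately have "q \<le> card {m' \<in> delivered i T. m' \<le> m}"
      by (intro from_busy[of 0 0 "{}"]) auto
    then show ?thesis ..
  next
    case True
    define s where "s = Max {r. r < T \<and> \<not> busy m r}"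
    have "s \<in> {r. r < T \<and> \<not> busy m r}" unfolding s_def using True by (intro Max_in) auto
    then have s: "s < T" "\<not> busy m s" by auto
    have busy_after: "busy m r" if "Suc s \<le> r" "r < T" for r
    proof (rule ccontr)
      assume "\<not> busy m r"
      then have "r \<le> s" unfolding s_def using that(2) by (intro Max_ge) auto
      then show False using that(1) by simp
    qed
    have known_delivered: "m' \<in> delivered i s" if "m' \<in> known s" "m' \<le> m" for m'
    proof -
      have "\<not> busy m' s" using busy_mono[OF _ that(2)] s(2) by blast
      then have "d \<le> sends s m'" using busyI[OF that(1)] by (meson not_le)
      then obtain r where "r < s" "r mod d = i" "packet r = Some m'"
        by (rule exhausted_residue[OF _ assms(1)])
      then show ?thesis by (auto simp: delivered_def)
    qed
    show ?thesis
    proof (cases "s < W")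
      \<comment> \<open>Before \<open>W\<close> nothing is known about the supply, but
        \<open>q\<close> whole tours still fit after \<open>s\<close>.\<close>
      case True
      then have "Suc s + d * (q - 0) \<le> T"
        unfolding T_def minus_nat.diff_0 using d_le[of q] by linarith
      then have "q \<le> card {m' \<in> delivered i T. m' \<le> m}"
        by (rule from_busy[OF _ busy_after, where A = "{}"]) simp_all
      then show ?thesis ..
    next
      case False
      \<comment> \<open>\<open>W + D * l\<close> is the last time not after \<open>s\<close> at
        which \<open>avail\<close> can be applied.\<close>
      define l where "l = (s - W) div D"
      have "D > 0" using assms(1,2) by simp
      have "D * l \<le> s - W" by (simp add: l_def)
      then have l: "W + D * l \<le> s" using False by linarith
      have "s - W < D * Suc l"
        using \<open>D > 0\<close> by (simp add: l_def dividend_less_times_div)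
      then have l': "s < W + D * Suc l" by linarith
      let ?A = "{m' \<in> known (W + D * l). m' \<le> m}"
      have A: "?A \<subseteq> {m' \<in> delivered i s. m' \<le> m}"
        using known_delivered known_mono[OF l] by blast
      consider "m \<in> known (W + D * l)" | "l \<le> card ?A" using avail[of l] by blast
      then show ?thesis
      proof cases
        case 1
        then have "m \<in> delivered i s" using A by auto
        then show ?thesis using delivered_mono[of s T i] s(1) by auto
      next
        case 2
        have A': "?A \<subseteq> {m' \<in> delivered i b. m' \<le> m}" if "s \<le> b" for b
          using A delivered_mono[OF that] by blast
        have fin: "finite ?A" using finite_known by simp
        show ?thesis
        proof (cases "l < q")
          case True
          then obtain j where j: "q = Suc (l + j)" using less_imp_Suc_add by blast
          have "d * (q - l) = d * j + d" "D * q = D * Suc l + D * j"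
            by (simp_all add: j algebra_simps)
          \<comment> \<open>\<open>Suc s\<close> may be as late as \<open>W + D * Suc l\<close>. The
            remaining \<open>D * j\<close> rounds cover \<open>j\<close> of the \<open>j + 1\<close>
            tours, and the extra \<open>d\<close> in \<open>T\<close> covers the last one.\<close>
          then have "Suc s + d * (q - l) \<le> T"
            unfolding T_def using l' d_le[of j] by linarith
          then have "q \<le> card {m' \<in> delivered i T. m' \<le> m}"
            by (rule from_busy[OF _ busy_after fin A' 2]) simp_all
          then show ?thesis ..
        next
          case False
          have "?A \<subseteq> {m' \<in> delivered i T. m' \<le> m}" using A' s(1) by simp
          then have "card ?A \<le> card {m' \<in> delivered i T. m' \<le> m}"
            using finite_delivered by (intro card_mono) auto
          then show ?thesis using 2 False by simp
        qed
      qed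
    qed
  qed
  then show ?thesis by (simp add: T_def)
qed

end

section \<open>Degree sums of shortest walks\<close>

context pair_graph
begin

abbreviation degree :: "'a \<Rightarrow> nat" where
  "degree \<equiv> out_degree (with_proj G)"

lemma degree_eq: "degree u = card {v. (u, v) \<in> parcs G}"
proof -
  have "out_arcs (with_proj G) u = Pair u ` {v. (u, v) \<in> parcs G}"
    by (auto simp: out_arcs_def)
  then show ?thesis by (simp add: out_degree_def card_image inj_on_def)
qed

text \<open>A hop costs one tour of the sender's neighbor list. Only tails count, since the final
  vertex need not forward.\<close>

definition walk_degree :: "('a \<times> 'a) list \<Rightarrow> nat" where
  "walk_degree p = (\<Sum>a\<leftarrow>p. degree (fst a))"

lemma walk_degree_le:
  assumes "awalk u p v" "\<And>w. w \<in> pverts G \<Longrightarrow> degree w \<le> D"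
  shows "walk_degree p \<le> D * length p"
proof -
  have "degree (fst a) \<le> D" if "a \<in> set p" for a
  proof -
    have "a \<in> parcs G" using assms(1) that by auto
    then show ?thesis using assms(2) arc_fst_in_verts by blast
  qed
  then have "walk_degree p \<le> (\<Sum>a\<leftarrow>p. D)"
    unfolding walk_degree_def by (intro sum_list_mono)
  then show ?thesis by (simp add: sum_list_triv mult.commute)
qed

lemma awalk_split_nth:
  assumes "awalk u p v" "i < length p"
  shows "awalk u (take i p) (fst (p ! i))" "awalk (fst (p ! i)) (drop i p) v"
proof -
  let ?x = "awlast u (take i p)"
  have "awalk u (take i p @ drop i p) v" using assms(1) by simp
  then have *: "awalk u (take i p) ?x" "awalk ?x (drop i p) v"
    unfolding awalk_append_iff by auto
  moreover have "?x = fst (p ! i)"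
    using *(2) by (simp add: Cons_nth_drop_Suc[OF assms(2), symmetric] awalk_Cons_iff)
  ultimately show "awalk u (take i p) (fst (p ! i))" "awalk (fst (p ! i)) (drop i p) v" by simp_all
qed

lemma awalk_append: "awalk u p v \<Longrightarrow> awalk v q w \<Longrightarrow> awalk u (p @ q) w"
  by auto

text \<open>
  Two tails of arcs of a shortest walk that have a common neighbor are at most two steps apart on
  the walk, so a vertex is adjacent to at most three of the tails.
\<close>

lemma shortest_walk_degree:
  assumes walk: "awalk u p v"
    and shortest: "\<And>p'. awalk u p' v \<Longrightarrow> length p \<le> length p'"
  shows "walk_degree p \<le> 3 * card (pverts G)"
proof -
  define x where "x i = fst (p ! i)" for i
  define S where "S w = {i \<in> {..<length p}. (x i, w) \<in> parcs G}" for w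
  have close: "j \<le> i + 2" if "i \<in> S w" "j \<in> S w" for i j w
  proof -
    have i: "i < length p" "(x i, w) \<in> parcs G" and j: "j < length p" "(w, x j) \<in> parcs G"
      using that arcs_symmetric by (auto simp: S_def)
    have "awalk (x i) [(x i, w), (w, x j)] (x j)"
      using i j by (auto simp: awalk_simps dest: in_arcsD2)
    \<comment> \<open>Going through \<open>w\<close> replaces the stretch of the walk from
      \<open>x i\<close> to \<open>x j\<close> by two arcs, which cannot shorten a shortest
      walk.\<close>
    then have "awalk u (take i p @ [(x i, w), (w, x j)] @ drop j p) v"
      using awalk_split_nth[OF walk i(1)] awalk_split_nth[OF walk j(1)] awalk_append
      unfolding x_def by blast
    then have "length p \<le> length (take i p @ [(x i, w), (w, x j)] @ drop j p)"
      by (rule shortest)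
    then show ?thesis using i(1) j(1) by simp
  qed
  have card_S: "card (S w) \<le> 3" for w
  proof (cases "S w = {}")
    case False
    have "finite (S w)" by (simp add: S_def)
    then have "S w \<subseteq> {Min (S w)..Min (S w) + 2}"
      using close[OF Min_in[OF _ False]] by auto
    then have "card (S w) \<le> card {Min (S w)..Min (S w) + 2}" by (intro card_mono) auto
    then show ?thesis by simp
  qed simp
  have "walk_degree p = (\<Sum>i\<in>{..<length p}. degree (x i))"
    by (simp add: walk_degree_def sum_list_sum_nth atLeast0LessThan x_def)
  also have "\<dots> = (\<Sum>i\<in>{..<length p}. card {w \<in> pverts G. (x i, w) \<in> parcs G})"
    unfolding degree_eq
    by (intro sum.cong refl arg_cong[where f = card]) (auto dest: in_arcsD2)
  \<comment> \<open>Double counting of the pairs of an index \<open>i\<close> and a neighbor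
    \<open>w\<close> of \<open>x i\<close>.\<close>
  also have "\<dots> = (\<Sum>w\<in>pverts G. card (S w))"
    by (rule sum_multicount_gen) (auto simp: S_def)
  also have "\<dots> \<le> (\<Sum>w\<in>pverts G. 3)" using card_S by (intro sum_mono)
  finally show ?thesis by (simp add: mult.commute)
qed

section \<open>Distances and maximum degree\<close>

lemma graph_dist_le: "awalk u p v \<Longrightarrow> graph_dist G u v \<le> length p"
  unfolding graph_dist_def by (rule Least_le) blast

text \<open>The \<open>LEAST\<close> in \<open>graph_dist\<close> is attained once some walk exists,
  and a connected symmetric digraph is strongly connected.\<close>

lemma graph_dist_walk:
  assumes "connected (with_proj G)" "u \<in> pverts G" "v \<in> pverts G"
  obtains p where "awalk u p v" "length p = graph_dist G u v"
proof -
  have "strongly_connected (with_proj G)"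
    using symmetric_connected_imp_strongly_connected[OF sym_arcs assms(1)] .
  then have "u \<rightarrow>\<^sup>*\<^bsub>with_proj G\<^esub> v" using assms(2,3) by auto
  then obtain q where "awalk u q v" unfolding reachable_awalk by blast
  then have "\<exists>l p. awalk u p v \<and> length p = l" by blast
  then have "\<exists>p. awalk u p v \<and> length p = graph_dist G u v"
    unfolding graph_dist_def by (rule LeastI_ex)
  then show thesis using that by blast
qed

lemma graph_dist_le_diameter:
  assumes "u \<in> pverts G" "v \<in> pverts G"
  shows "graph_dist G u v \<le> diameter G"
proof -
  have "{graph_dist G u v |u v. u \<in> pverts G \<and> v \<in> pverts G} =
      case_prod (graph_dist G) ` (pverts G \<times> pverts G)"
    by auto
  then show ?thesis unfolding diameter_def using assms pair_finite_verts by (intro Max_ge) auto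
qed

lemma degree_le_max_degree: "u \<in> pverts G \<Longrightarrow> degree u \<le> max_degree G"
  unfolding max_degree_def using pair_finite_verts by (intro Max_ge) auto

end

section \<open>Routing along a walk\<close>

locale round_robin_routing = pair_graph G for G :: "'a pair_pre_digraph" +
  fixes nbrs :: "'a \<Rightarrow> 'a list" and M :: "'m :: linorder set" and init :: "'a \<Rightarrow> 'm set"
  assumes finite_messages: "finite M"
    and init_messages: "(\<Union>u\<in>pverts G. init u) = M"
    and neighbor_orders: "neighbor_orders G nbrs"
begin

abbreviation state :: "nat \<Rightarrow> ('a, 'm) routing_state" where
  "state \<equiv> routing G nbrs init"

section \<open>Invariants of the routing state\<close>

lemma known_mono: "r \<le> t \<Longrightarrow> known (state r) v \<subseteq> known (state t) v"
  by (induction rule: dec_induct) (auto simp: routing_step_def)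

lemma packet_known:
  assumes "packet G s u = Some m" "finite (known s u)"
  shows "m \<in> known s u"
proof -
  let ?P = "{m \<in> known s u. sent s u m < degree u}"
  have "?P \<noteq> {}" "m = Min ?P"
    using assms(1) by (auto simp: packet_def Let_def split: if_splits)
  then show ?thesis using Min_in[of ?P] assms(2) by auto
qed

lemma exchange_verts: "exchange G nbrs t u v \<Longrightarrow> u \<in> pverts G \<and> v \<in> pverts G"
  by (auto simp: exchange_def initiates_def dest: in_arcsD1 in_arcsD2)

lemma known_subset: "u \<in> pverts G \<Longrightarrow> known (state t) u \<subseteq> M"
proof (induction t arbitrary: u)
  case 0
  then show ?case using init_messages by auto
next
  case (Suc t)
  have "m \<in> M" if "exchange G nbrs t v u" "packet G (state t) v = Some m" for v m
  proof -
    have v: "known (state t) v \<subseteq> M" using Suc.IH exchange_verts[OF that(1)] by blast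
    then show ?thesis
      using packet_known[OF that(2)] finite_subset[OF v finite_messages] by blast
  qed
  then show ?case using Suc by (auto simp: routing_step_def)
qed

lemma finite_known: "u \<in> pverts G \<Longrightarrow> finite (known (state t) u)"
  using known_subset finite_messages finite_subset by blast

lemma sent_eq: "sent (state t) u m = card {r. r < t \<and> packet G (state r) u = Some m}"
proof (induction t)
  case (Suc t)
  have "{r. r < Suc t \<and> packet G (state r) u = Some m} =
      {r. r < t \<and> packet G (state r) u = Some m} \<union>
      (if packet G (state t) u = Some m then {t} else {})"
    by (auto simp: less_Suc_eq)
  then show ?case using Suc by (simp add: routing_step_def)
qed simp

text \<open>By \<open>sent_eq\<close> the counter in the state is the number of earlier sending
  rounds, so the analysis of a single sender applies to every node.\<close>

lemma prioritized_sender: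
  assumes "u \<in> pverts G"
  shows "prioritized_sender (\<lambda>t. known (state t) u) (\<lambda>t. packet G (state t) u) (degree u)"
proof
  show "finite (known (state t) u)" for t using finite_known[OF assms] .
  show "known (state r) u \<subseteq> known (state t) u" if "r \<le> t" for r t using known_mono that .
  show "packet G (state t) u =
    (let P = {m \<in> known (state t) u. card {r. r < t \<and> packet G (state r) u = Some m} < degree u}
     in if P = {} then None else Some (Min P))" for t
    by (subst packet_def) (simp add: sent_eq)
qed

text \<open>The slot is the position of \<open>v\<close> in \<open>nbrs u\<close>. As this list is
  distinct, the period of the tour equals the degree, which is also the limit on
  transmissions.\<close>

lemma neighbor_slot:
  assumes "(u, v) \<in> parcs G"
  obtains i where "i < degree u" "\<And>t. t mod degree u = i \<Longrightarrow> exchange G nbrs t u v"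
proof -
  have nbrs: "distinct (nbrs u)" "set (nbrs u) = {v. (u, v) \<in> parcs G}"
    using neighbor_orders in_arcsD1[OF assms] by (auto simp: neighbor_orders_def)
  then have len: "length (nbrs u) = degree u"
    using distinct_card[OF nbrs(1)] by (simp add: degree_eq)
  obtain i where "i < length (nbrs u)" "nbrs u ! i = v"
    using assms nbrs(2) by (metis in_set_conv_nth mem_Collect_eq)
  then show thesis
    using that[of i] assms len by (auto simp: exchange_def initiates_def)
qed

text \<open>
  Counting smaller messages is what makes the bound additive: an intermediate node may still
  wait for \<open>m\<close>, but then it has been supplied with smaller messages at the full rate.
\<close>

lemma known_along_walk:
  assumes "awalk u p v" "m \<in> init u"
    and max: "\<And>w. w \<in> pverts G \<Longrightarrow> degree w \<le> D"
  shows "m \<in> known (state (walk_degree p + D * q)) v \<or>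
    q \<le> card {m' \<in> known (state (walk_degree p + D * q)) v. m' \<le> m}"
  using assms(1)
\<comment> \<open>The walk grows at its end, and \<open>q\<close> is arbitrary because one hop draws
  on the sender's guarantee for all values of \<open>q\<close>.\<close>
proof (induction p arbitrary: v q rule: rev_induct)
  case Nil
  then have "m \<in> known (state 0) v" using assms(2) by (simp add: awalk_Nil_iff)
  then show ?case using known_mono[of 0] by blast
next
  case (snoc a p)
  obtain w x where a: "a = (w, x)" by (cases a)
  have walk: "awalk u p w" "(w, v) \<in> parcs G" "x = v"
    using snoc.prems by (auto simp: a awalk_simps)
  then have w: "w \<in> pverts G" "v \<in> pverts G" by (auto dest: in_arcsD1 in_arcsD2)
  interpret w: prioritized_sender "\<lambda>t. known (state t) w" "\<lambda>t. packet G (state t) w" "degree w"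
    using prioritized_sender[OF w(1)] .
  obtain i where i: "i < degree w" "\<And>t. t mod degree w = i \<Longrightarrow> exchange G nbrs t w v"
    using neighbor_slot[OF walk(2)] by blast
  define T where "T = walk_degree p + degree w + D * q"
  have T: "walk_degree (p @ [a]) + D * q = T" by (simp add: walk_degree_def T_def a)
  have "m \<in> w.delivered i T \<or> q \<le> card {m' \<in> w.delivered i T. m' \<le> m}"
    unfolding T_def using w.delivered_of_known[OF i(1) max[OF w(1)]] snoc.IH[OF walk(1)] by blast
  moreover have sub: "w.delivered i T \<subseteq> known (state T) v"
  proof
    fix m' assume "m' \<in> w.delivered i T"
    then obtain r where r: "r < T" "r mod degree w = i" "packet G (state r) w = Some m'"
      by (auto simp: w.delivered_def)
    then have "m' \<in> known (state (Suc r)) v" using i(2) by (auto simp: routing_step_def)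
    then show "m' \<in> known (state T) v" using known_mono[of "Suc r" T] r(1) by auto
  qed
  moreover have "card {m' \<in> w.delivered i T. m' \<le> m} \<le> card {m' \<in> known (state T) v. m' \<le> m}"
    using sub finite_known[OF w(2)] by (intro card_mono) auto
  ultimately show ?case unfolding T using le_trans by blast
qed

text \<open>Let \<open>q\<close> be the rank of \<open>m\<close> in \<open>M\<close>. A node that
  knows this many messages up to \<open>m\<close> knows all of them, including \<open>m\<close>; and
  the rank is at most \<open>card M\<close>.\<close>

lemma known_of_walk:
  assumes "awalk u p v" "m \<in> init u"
    and "\<And>w. w \<in> pverts G \<Longrightarrow> degree w \<le> D"
    and "walk_degree p + D * card M \<le> t"
  shows "m \<in> known (state t) v"
proof -
  define T where "T = walk_degree p + D * card {m' \<in> M. m' \<le> m}"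
  have u: "u \<in> pverts G" "v \<in> pverts G" using assms(1) by auto
  then have m: "m \<in> M" using assms(2) init_messages by blast
  have "m \<in> known (state T) v"
  proof (rule ccontr)
    assume "m \<notin> known (state T) v"
    then have "card {m' \<in> M. m' \<le> m} \<le> card {m' \<in> known (state T) v. m' \<le> m}"
      using known_along_walk[OF assms(1-3)] unfolding T_def by blast
    then have "{m' \<in> known (state T) v. m' \<le> m} = {m' \<in> M. m' \<le> m}"
      using known_subset[OF u(2)] finite_messages by (intro card_seteq) auto
    then show False using m \<open>m \<notin> known (state T) v\<close> by auto
  qed
  moreover have "card {m' \<in> M. m' \<le> m} \<le> card M"
    using finite_messages by (intro card_mono) auto
  then have "T \<le> t"
    using assms(4) mult_le_mono2 unfolding T_def by (meson add_left_mono le_trans)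
  ultimately show ?thesis using known_mono by blast
qed

end

theorem theorem3:
  fixes G :: "'a pair_pre_digraph"
    and nbrs :: "'a \<Rightarrow> 'a list"
    and M :: "'m :: linorder set"
    and init :: "'a \<Rightarrow> 'm set"
    and n k :: nat
  assumes "pair_graph G"
    and "Digraph_Component.connected (with_proj G)"
    and "n = card (pverts G)"
    and "finite M" and "card M = k"
    and "(\<Union>u\<in>pverts G. init u) = M"
    and "neighbor_orders G nbrs"
  shows "\<forall>u\<in>pverts G.
    known (routing G nbrs init
      (min (3 * n) (max_degree G * diameter G) + max_degree G * k)) u = M"
proof -
  interpret round_robin_routing G nbrs M init
    using assms(1,4,6,7) by (simp add: round_robin_routing_def round_robin_routing_axioms_def)
  let ?t = "min (3 * n) (max_degree G * diameter G) + max_degree G * k"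
  have "m \<in> known (state ?t) v" if v: "v \<in> pverts G" and m: "m \<in> M" for v m
  proof -
    obtain u where u: "u \<in> pverts G" "m \<in> init u" using m init_messages by blast
    obtain p where p: "awalk u p v" "length p = graph_dist G u v"
      using graph_dist_walk[OF assms(2) u(1) v] .
    \<comment> \<open>A shortest walk satisfies both bounds on the degree sum, hence the bound by
      their minimum.\<close>
    have "walk_degree p \<le> 3 * n"
      using shortest_walk_degree[OF p(1)] graph_dist_le p(2) assms(3) by simp
    moreover have "walk_degree p \<le> max_degree G * diameter G"
      using walk_degree_le[OF p(1) degree_le_max_degree]
        mult_le_mono2[OF graph_dist_le_diameter[OF u(1) v]] p(2)
      by (metis le_trans)
    ultimately show ?thesis
      using known_of_walk[OF p(1) u(2) degree_le_max_degree] assms(5) by simp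
  qed
  then show ?thesis using known_subset by blast
qed

end
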